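(* Let $n\ge 1$ and let $(\xi_i,\mathfrak{F}_i)_{i=0,\dots,n}$ be a sequence of square integrable real-valued martingale differences with $\xi_0=0$; let $S_n=\sum_{i=1}^n\xi_i$ and $[S]_n=\sum_{i=1}^n\xi_i^2$. Assume that $\xi_i$ is heavy on left for all $i$. Then for all $b>0$, $M\geq 1$ and $x>0$, \[ \mathbb{P}\Big(\frac{S_n}{\sqrt{[S]_n}}\geq x,\ b\leq \sqrt{[S]_n}\leq bM\Big) \leq \sqrt{e}\,\big(1+2(1+x)\ln M\big)\exp\Big\{-\frac{1}{2}x^2\Big\}. \]
   Context: $(\Omega,\mathfrak F,\mathbb P)$ is a probability space with increasing $\sigma$-fields $\{\emptyset,\Omega\}=\mathfrak F_0\subseteq\cdots\subseteq\mathfrak F_n\subseteq\mathfrak F$; each $\xi_i$ is $\mathfrak F_i$-measurable, $\mathbb E[\xi_i\mid\mathfrak F_{i-1}]=0$ and $\mathbb E[\xi_i^2]<\infty$ for $i\ge1$. An integrable random variable $X$ is called heavy on left if $\mathbb E X=0$ and, for all $a>0$, $\mathbb E[T_a(X)]\le 0$, where $T_a(X)=\min(|X|,a)\,\mathrm{sign}(X)$ is the truncated version of $X$.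
   Formalization: "Heavy on left" is taken conditionally: E[T_a(ξ_i)|F_{i-1}] ≤ 0 a.s. for all a>0, in place of E[T_a(ξ_i)] ≤ 0; with plain expectations the claim is false (a counterexample exists with n=3, M=1, b=x=√3). *)

theory Defs
  imports "HOL-Probability.Probability"
begin

definition truncated :: "real \<Rightarrow> real \<Rightarrow> real"
  where "truncated a y = min \<bar>y\<bar> a * sgn y"

definition heavy_on_left :: "'a measure \<Rightarrow> ('a \<Rightarrow> real) \<Rightarrow> bool"
  where "heavy_on_left P X \<longleftrightarrow>
    integrable P X \<and> integral\<^sup>L P X = 0 \<and>
    (\<forall>a>0. integral\<^sup>L P (\<lambda>\<omega>. truncated a (X \<omega>)) \<le> 0)"

(* The notion for martingale differences: the defining (in)equalities of heavy_on_left, for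
   conditional expectations given G.  For trivial G it is heavy_on_left; in general it implies it
   (both are proved below).  For the increments of a martingale it is this conditional form that is
   meant: the unconditional one leaves the joint law almost unrestricted, since asymmetries of
   opposite sign on two halves of the past cancel in the marginal law. *)
definition cond_heavy_on_left :: "'a measure \<Rightarrow> 'a measure \<Rightarrow> ('a \<Rightarrow> real) \<Rightarrow> bool"
  where "cond_heavy_on_left P G X \<longleftrightarrow>
    integrable P X \<and> (AE \<omega> in P. real_cond_exp P G X \<omega> = 0) \<and>
    (\<forall>a>0. AE \<omega> in P. real_cond_exp P G (\<lambda>\<omega>. truncated a (X \<omega>)) \<omega> \<le> 0)"

(* Only the indices 0..n of F and \<xi> are constrained. *)
definition sq_int_martingale_differences ::
    "'a measure \<Rightarrow> nat \<Rightarrow> (nat \<Rightarrow> 'a measure) \<Rightarrow> (nat \<Rightarrow> 'a \<Rightarrow> real) \<Rightarrow> bool"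
  where "sq_int_martingale_differences P n F \<xi> \<longleftrightarrow>
    (\<forall>i\<le>n. subalgebra P (F i)) \<and>
    (\<forall>i\<le>n. \<forall>j\<le>i. sets (F j) \<subseteq> sets (F i)) \<and>
    sets (F 0) = {{}, space P} \<and>
    (\<forall>i\<le>n. \<xi> i \<in> borel_measurable (F i)) \<and>
    (\<forall>\<omega>\<in>space P. \<xi> 0 \<omega> = 0) \<and>
    (\<forall>i\<in>{1..n}. integrable P (\<lambda>\<omega>. (\<xi> i \<omega>)\<^sup>2)) \<and>
    (\<forall>i\<in>{1..n}. AE \<omega> in P. real_cond_exp P (F (i - 1)) (\<xi> i) \<omega> = 0)"

lemma truncated_measurable [measurable]: "truncated a \<in> borel_measurable borel"
  unfolding truncated_def by measurable

lemma abs_truncated_le: "0 < a \<Longrightarrow> \<bar>truncated a y\<bar> \<le> \<bar>y\<bar>"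
  by (auto simp: truncated_def abs_mult sgn_if)

lemma integrable_truncated:
  assumes "integrable P X" "0 < a"
  shows "integrable P (\<lambda>\<omega>. truncated a (X \<omega>))"
proof (rule Bochner_Integration.integrable_bound[OF assms(1)])
  show "(\<lambda>\<omega>. truncated a (X \<omega>)) \<in> borel_measurable P"
    using borel_measurable_integrable[OF assms(1)] by measurable
qed (use abs_truncated_le[OF assms(2)] in auto)

lemma cond_heavy_on_left_imp_heavy_on_left:
  assumes "prob_space P" "subalgebra P G" "cond_heavy_on_left P G X"
  shows "heavy_on_left P X"
proof -
  interpret prob_space P by fact
  interpret finite_measure_subalgebra P G by standard fact
  have X: "integrable P X" and X0: "AE \<omega> in P. real_cond_exp P G X \<omega> = 0"
    and Xa: "\<And>a. 0 < a \<Longrightarrow> AE \<omega> in P. real_cond_exp P G (\<lambda>\<omega>. truncated a (X \<omega>)) \<omega> \<le> 0"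
    using assms(3) by (auto simp: cond_heavy_on_left_def)
  have "integral\<^sup>L P X = integral\<^sup>L P (real_cond_exp P G X)"
    using real_cond_exp_int(2)[OF X] by simp
  also have "\<dots> = 0"
    using integral_cong_AE[of "real_cond_exp P G X" P "\<lambda>_. 0"] X0 by simp
  finally have 1: "integral\<^sup>L P X = 0" .
  have 2: "integral\<^sup>L P (\<lambda>\<omega>. truncated a (X \<omega>)) \<le> 0" if "0 < a" for a
  proof -
    note T = real_cond_exp_int[OF integrable_truncated[OF X that]]
    have "integral\<^sup>L P (real_cond_exp P G (\<lambda>\<omega>. truncated a (X \<omega>))) \<le> integral\<^sup>L P (\<lambda>_. 0)"
      using T(1) Xa[OF that] by (intro integral_mono_AE) auto
    then show ?thesis using T(2) by simp
  qed
  show ?thesis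
    using X 1 2 by (simp add: heavy_on_left_def)
qed

lemma cond_heavy_on_left_trivial_iff:
  assumes "prob_space P" "subalgebra P G" "sets G = {{}, space P}"
  shows "cond_heavy_on_left P G X \<longleftrightarrow> heavy_on_left P X"
proof
  assume "cond_heavy_on_left P G X"
  then show "heavy_on_left P X"
    using cond_heavy_on_left_imp_heavy_on_left[OF assms(1,2)] by blast
next
  assume X: "heavy_on_left P X"
  interpret prob_space P by fact
  interpret finite_measure_subalgebra P G by standard fact
  have const: "AE \<omega> in P. real_cond_exp P G f \<omega> = integral\<^sup>L P f" if "integrable P f" for f
  proof (rule real_cond_exp_charact)
    fix A assume "A \<in> sets G"
    then have "A = {} \<or> A = space P" using assms(3) by auto
    then show "set_lebesgue_integral P A f = (LINT x:A|P. integral\<^sup>L P f)"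
      by (auto simp: set_lebesgue_integral_def prob_space cong: Bochner_Integration.integral_cong)
  qed (use that in auto)
  show "cond_heavy_on_left P G X"
    unfolding cond_heavy_on_left_def
  proof (intro conjI allI impI)
    show i: "integrable P X" using X by (simp add: heavy_on_left_def)
    show "AE \<omega> in P. real_cond_exp P G X \<omega> = 0"
      using const[OF i] X by (simp add: heavy_on_left_def)
    fix a :: real assume "0 < a"
    then have "integral\<^sup>L P (\<lambda>\<omega>. truncated a (X \<omega>)) \<le> 0"
      using X by (simp add: heavy_on_left_def)
    with const[OF integrable_truncated[OF i \<open>0 < a\<close>]]
    show "AE \<omega> in P. real_cond_exp P G (\<lambda>\<omega>. truncated a (X \<omega>)) \<omega> \<le> 0"
      by (auto elim: eventually_mono)
  qed
qed

end

theory Submission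
  imports Defs
begin

text \<open>
  Write \<open>S\<close> for the martingale and \<open>V\<close> for the square root of its quadratic variation. The bound
  rests on one property of heavy on left variables: for \<open>t > 0\<close> the variable
  \<open>exp (t X - (t X)\<^sup>2 / 2)\<close> has conditional mean at most 1. Hence the products of these variables
  along the increments, which are \<open>exp (t S - t\<^sup>2 V\<^sup>2 / 2)\<close>, have mean at most 1
  (\<open>exponential_supermartingale\<close>).

  For the mean bound, let \<open>f y = exp (y - y\<^sup>2 / 2)\<close>, and let \<open>\<phi>\<close> be the odd function that equals
  \<open>f - 1\<close> on the negative half-line. On the positive half-line \<open>f \<le> 1 + \<phi>\<close> says
  \<open>f y + f (- y) \<le> 2\<close>, that is \<open>cosh y \<le> exp (y\<^sup>2 / 2)\<close>. Moreover \<open>\<phi>\<close> is concave on the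
  positive half-line, bounded, and vanishes at 0. Such a function is a mixture
  \<open>\<integral> h s * min y s ds\<close> with weights \<open>h = - \<phi>'' \<ge> 0\<close>; as \<open>\<phi>\<close> is odd, it is a mixture of the
  truncations \<open>T\<^sub>s\<close> on the whole line (\<open>odd_majorant_mixture_of_truncations\<close>). Since every truncation
  of a heavy on left variable has mean at most 0, so has \<open>\<phi>\<close>, and the mean of \<open>f\<close> is at most 1.
  The conditional statement is obtained by testing against bounded nonnegative weights measurable
  in the past, which avoids choosing versions of conditional expectations for
  uncountably many truncation levels at once (\<open>integral_weighted_exp_le\<close>).

  For the tail bound, suppose \<open>S \<ge> x V\<close> and put \<open>u = t V\<close>. Then
  \<open>t S - t\<^sup>2 V\<^sup>2 / 2 \<ge> x u - u\<^sup>2 / 2 = x\<^sup>2 / 2 - (u - x)\<^sup>2 / 2\<close>, which is at least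
  \<open>x\<^sup>2 / 2 - 1 / 2\<close> as long as \<open>u\<close> lies in \<open>[x, x + 1]\<close>. With \<open>t = x / c\<close> this covers the slice
  \<open>c \<le> V \<le> c (1 + 1 / x)\<close>, and Markov's inequality bounds its probability by
  \<open>sqrt e * exp (- x\<^sup>2 / 2)\<close> (\<open>self_normalized_slice\<close>). The range \<open>[b, b M]\<close> is covered by at
  most \<open>1 + ln M / ln (1 + 1 / x) \<le> 1 + (1 + x) ln M\<close> slices in geometric progression.
\<close>

section \<open>A majorant that is a mixture of truncations\<close>

text \<open>
  Divided by \<open>2 exp (- y\<^sup>2 / 2)\<close>, this is \<open>cosh y \<le> exp (y\<^sup>2 / 2)\<close>. The left side decreases from 2,
  because the sign of its derivative is governed by \<open>(1 - s) exp (2 s) \<le> 1 + s\<close>.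
\<close>

lemma exp_minus_half_square_add_reflected_le_2:
  fixes y :: real
  assumes "0 \<le> y"
  shows "exp (y - y\<^sup>2 / 2) + exp (- y - y\<^sup>2 / 2) \<le> 2"
proof -
  have key: "0 \<le> (1 + s) - (1 - s) * exp (2 * s)" if "0 \<le> s" for s :: real
  proof -
    let ?k = "\<lambda>s::real. (1 + s) - (1 - s) * exp (2 * s)"
    have "?k 0 \<le> ?k s"
    proof (rule DERIV_nonneg_imp_nondecreasing[OF that])
      fix r :: real
      have "(?k has_real_derivative exp (2 * r) * (exp (- (2 * r)) - (1 + - (2 * r)))) (at r)"
        by (auto intro!: derivative_eq_intros simp: algebra_simps exp_minus)
      moreover have "0 \<le> exp (2 * r) * (exp (- (2 * r)) - (1 + - (2 * r)))"
        using exp_ge_add_one_self[of "- (2 * r)"] by simp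
      ultimately show "\<exists>d. (?k has_real_derivative d) (at r) \<and> 0 \<le> d" by blast
    qed
    then show ?thesis by simp
  qed
  let ?q = "\<lambda>s::real. exp (s - s\<^sup>2 / 2) + exp (- s - s\<^sup>2 / 2)"
  have "?q y \<le> ?q 0"
  proof (rule DERIV_nonpos_imp_nonincreasing[OF assms])
    fix s :: real assume s: "0 \<le> s"
    have "(?q has_real_derivative
        - (exp (- s - s\<^sup>2 / 2) * ((1 + s) - (1 - s) * exp (2 * s)))) (at s)"
      by (auto intro!: derivative_eq_intros simp: algebra_simps simp flip: exp_add)
    moreover have "- (exp (- s - s\<^sup>2 / 2) * ((1 + s) - (1 - s) * exp (2 * s))) \<le> 0"
      using key[OF s] by simp
    ultimately show "\<exists>d. (?q has_real_derivative d) (at s) \<and> d \<le> 0" by blast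
  qed
  then show ?thesis by simp
qed

text \<open>The odd function that agrees with \<open>exp (y - y\<^sup>2 / 2) - 1\<close> for \<open>y \<le> 0\<close>.\<close>
definition odd_majorant :: "real \<Rightarrow> real"
  where "odd_majorant y = sgn y * (1 - exp (- \<bar>y\<bar> - y\<^sup>2 / 2))"

lemma odd_majorant_measurable [measurable]: "odd_majorant \<in> borel_measurable borel"
  unfolding odd_majorant_def by measurable

lemma abs_odd_majorant_le_1: "\<bar>odd_majorant y\<bar> \<le> 1"
proof -
  have "- \<bar>y\<bar> - y\<^sup>2 / 2 \<le> 0" using zero_le_power2[of y] by linarith
  then have "\<bar>1 - exp (- \<bar>y\<bar> - y\<^sup>2 / 2)\<bar> \<le> 1"
    unfolding exp_le_one_iff[symmetric] using exp_gt_zero[of "- \<bar>y\<bar> - y\<^sup>2 / 2"] by linarith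
  moreover have "\<bar>sgn y\<bar> \<le> 1" by (simp add: sgn_real_def)
  ultimately show ?thesis unfolding odd_majorant_def abs_mult by (intro mult_le_one) auto
qed

lemma exp_minus_half_square_le_odd_majorant: "exp (y - y\<^sup>2 / 2) \<le> 1 + odd_majorant y"
  using exp_minus_half_square_add_reflected_le_2[of y]
  by (cases "0 < y"; cases "y = 0") (auto simp: odd_majorant_def sgn_if)

text \<open>
  Minus the second derivative of \<^const>\<open>odd_majorant\<close> on the positive half-line, extended by 0. It is
  the second-order weight in Taylor's formula, hence the density of the truncation level.
\<close>
definition mixing_density :: "real \<Rightarrow> real"
  where "mixing_density s = indicator {0..} s * ((2 * s + s\<^sup>2) * exp (- s - s\<^sup>2 / 2))"

lemma mixing_density_measurable [measurable]: "mixing_density \<in> borel_measurable borel"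
  unfolding mixing_density_def by measurable

lemma mixing_density_nonneg: "0 \<le> mixing_density s"
  by (auto simp: mixing_density_def indicator_def)

text \<open>The right-hand side is the slope of \<^const>\<open>odd_majorant\<close> at \<open>y\<close>, which vanishes at infinity.\<close>
lemma mixing_density_tail:
  assumes "0 \<le> y"
  shows "has_bochner_integral lborel (\<lambda>s. mixing_density s * indicator {y..} s)
           ((1 + y) * exp (- y - y\<^sup>2 / 2))"
proof (rule has_bochner_integral_nn_integral)
  let ?g = "\<lambda>s::real. - ((1 + s) * exp (- s - s\<^sup>2 / 2))"
  let ?h = "\<lambda>s::real. (2 * s + s\<^sup>2) * exp (- s - s\<^sup>2 / 2)"
  have lim: "((\<lambda>s::real. - ((1 + s) * exp (- s - s\<^sup>2 / 2))) \<longlongrightarrow> 0) at_top"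
  proof (rule tendsto_sandwich[where f = "\<lambda>s. - (exp (-s) + s ^ 1 / exp s)" and h = "\<lambda>_. 0"])
    show "((\<lambda>s::real. - (exp (- s) + s ^ 1 / exp s)) \<longlongrightarrow> 0) at_top"
      by (rule tendsto_eq_intros tendsto_power_div_exp_0
            filterlim_compose[OF exp_at_bot filterlim_uminus_at_bot_at_top] | simp)+
    show "\<forall>\<^sub>F s::real in at_top. - (exp (- s) + s ^ 1 / exp s) \<le> - ((1 + s) * exp (- s - s\<^sup>2 / 2))"
      using eventually_ge_at_top[of 0]
    proof eventually_elim
      case (elim s)
      have "(1 + s) * exp (- s - s\<^sup>2 / 2) \<le> (1 + s) * exp (- s)"
        using elim by (intro mult_left_mono) auto
      also have "\<dots> = exp (- s) + s ^ 1 / exp s"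
        by (simp add: algebra_simps exp_minus divide_inverse)
      finally show ?case by simp
    qed
    show "\<forall>\<^sub>F s::real in at_top. - ((1 + s) * exp (- s - s\<^sup>2 / 2)) \<le> 0"
      using eventually_ge_at_top[of 0] by eventually_elim auto
  qed auto
  have "(\<integral>\<^sup>+s. ennreal (?h s) * indicator {y..} s \<partial>lborel) = ennreal (0 - ?g y)"
  proof (rule nn_integral_FTC_atLeast)
    fix s assume "y \<le> s"
    show "(?g has_real_derivative ?h s) (at s)"
      by (auto intro!: derivative_eq_intros simp: algebra_simps power2_eq_square)
    show "0 \<le> ?h s" using \<open>y \<le> s\<close> assms by auto
  qed (use lim in auto)
  also have "(\<integral>\<^sup>+s. ennreal (?h s) * indicator {y..} s \<partial>lborel)
      = (\<integral>\<^sup>+s. ennreal (mixing_density s * indicator {y..} s) \<partial>lborel)"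
    using assms by (intro nn_integral_cong) (auto simp: mixing_density_def split: split_indicator)
  finally show "(\<integral>\<^sup>+s. ennreal (mixing_density s * indicator {y..} s) \<partial>lborel)
      = ennreal ((1 + y) * exp (- y - y\<^sup>2 / 2))" by simp
qed (use assms in \<open>auto simp: mixing_density_nonneg\<close>)

lemma mixing_density_integral: "has_bochner_integral lborel mixing_density 1"
proof -
  have "(\<lambda>s. mixing_density s * indicator {0..} s) = mixing_density"
    by (auto simp: mixing_density_def fun_eq_iff split: split_indicator)
  then show ?thesis using mixing_density_tail[of 0] by simp
qed

text \<open>
  For \<open>y > 0\<close> this is Taylor's formula: levels below \<open>y\<close> contribute by integration by parts, and
  levels above \<open>y\<close> contribute \<open>y\<close> times the slope at \<open>y\<close>; the two boundary terms cancel. Both sides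
  are odd in \<open>y\<close>.
\<close>
lemma odd_majorant_mixture_of_truncations:
  "has_bochner_integral lborel (\<lambda>s. mixing_density s * truncated s y) (odd_majorant y)"
proof -
  define z where "z = \<bar>y\<bar>"
  have z: "0 \<le> z" by (simp add: z_def)
  let ?h = "\<lambda>s::real. (2 * s + s\<^sup>2) * exp (- s - s\<^sup>2 / 2)"
  \<comment> \<open>An antiderivative of \<open>s * ?h s\<close>, from integration by parts.\<close>
  let ?E = "\<lambda>s::real. - (exp (- s - s\<^sup>2 / 2) * (1 + s * (1 + s)))"
  have head: "has_bochner_integral lborel (\<lambda>s. (s * ?h s) * indicator {0..z} s) (?E z - ?E 0)"
  proof (rule has_bochner_integral_FTC_Icc_real[OF z])
    fix s :: real
    show "(?E has_real_derivative s * ?h s) (at s)"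
      by (auto intro!: derivative_eq_intros simp: algebra_simps power2_eq_square)
    show "isCont (\<lambda>s. s * ?h s) s" by (auto intro!: continuous_intros)
  qed
  note tail = has_bochner_integral_mult_right[OF mixing_density_tail[OF z], of z]
  have "has_bochner_integral lborel
      (\<lambda>s. (s * ?h s) * indicator {0..z} s + z * (mixing_density s * indicator {z..} s))
      (?E z - ?E 0 + z * ((1 + z) * exp (- z - z\<^sup>2 / 2)))"
    using head tail by (intro has_bochner_integral_add) auto
  also have "?E z - ?E 0 + z * ((1 + z) * exp (- z - z\<^sup>2 / 2)) = 1 - exp (- z - z\<^sup>2 / 2)"
    by (simp add: algebra_simps)
  also have "has_bochner_integral lborel
      (\<lambda>s. (s * ?h s) * indicator {0..z} s + z * (mixing_density s * indicator {z..} s))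
      (1 - exp (- z - z\<^sup>2 / 2)) \<longleftrightarrow>
      has_bochner_integral lborel (\<lambda>s. mixing_density s * min z s) (1 - exp (- z - z\<^sup>2 / 2))"
  proof (rule has_bochner_integral_cong_AE)
    \<comment> \<open>The two integrals overlap at \<open>s = z\<close>, a null set.\<close>
    show "AE s in lborel. (s * ?h s) * indicator {0..z} s + z * (mixing_density s * indicator {z..} s)
        = mixing_density s * min z s"
      using AE_lborel_singleton[of z]
      by eventually_elim (use z in \<open>auto simp: mixing_density_def min_def split: split_indicator\<close>)
  qed auto
  finally have "has_bochner_integral lborel (\<lambda>s. sgn y * (mixing_density s * min z s))
      (sgn y * (1 - exp (- z - z\<^sup>2 / 2)))"
    by (rule has_bochner_integral_mult_right)
  then show ?thesis
    by (simp add: z_def truncated_def odd_majorant_def mult_ac)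
qed

section \<open>Conditional exponential moments of heavy on left variables\<close>

lemma truncated_mult:
  "0 < t \<Longrightarrow> truncated a (t * y) = t * truncated (a / t) y"
  by (auto simp: truncated_def sgn_mult abs_mult min_def field_simps)

lemma cond_heavy_on_left_mult:
  assumes "prob_space P" "subalgebra P G" "cond_heavy_on_left P G X" "0 < t"
  shows "cond_heavy_on_left P G (\<lambda>\<omega>. t * X \<omega>)"
proof -
  interpret prob_space P by fact
  interpret finite_measure_subalgebra P G by standard fact
  have X: "integrable P X" and X0: "AE \<omega> in P. real_cond_exp P G X \<omega> = 0"
    using assms(3) by (auto simp: cond_heavy_on_left_def)
  have scale: "AE \<omega> in P. real_cond_exp P G (\<lambda>\<omega>. t * f \<omega>) \<omega> = t * real_cond_exp P G f \<omega>"
    if "integrable P f" for f using that by (rule real_cond_exp_cmult)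
  have "AE \<omega> in P. real_cond_exp P G (\<lambda>\<omega>. t * X \<omega>) \<omega> = 0"
    using scale[OF X] X0 by eventually_elim simp
  moreover have "AE \<omega> in P. real_cond_exp P G (\<lambda>\<omega>. truncated a (t * X \<omega>)) \<omega> \<le> 0" if "0 < a" for a
  proof -
    have "0 < a / t" using that assms(4) by simp
    then have "AE \<omega> in P. real_cond_exp P G (\<lambda>\<omega>. truncated (a / t) (X \<omega>)) \<omega> \<le> 0"
      using assms(3) by (auto simp: cond_heavy_on_left_def)
    then show ?thesis
      using scale[OF integrable_truncated[OF X \<open>0 < a / t\<close>]]
      unfolding truncated_mult[OF assms(4)]
      by eventually_elim (use assms(4) in \<open>simp add: mult_nonneg_nonpos\<close>)
  qed
  ultimately show ?thesis using X by (auto simp: cond_heavy_on_left_def)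
qed

lemma integral_weighted_truncated_nonpos:
  assumes "prob_space P" "subalgebra P G" "cond_heavy_on_left P G X"
    and [measurable]: "Y \<in> borel_measurable G" and Y: "\<And>\<omega>. 0 \<le> Y \<omega>" "\<And>\<omega>. Y \<omega> \<le> C"
    and "0 < a"
  shows "(\<integral>\<omega>. Y \<omega> * truncated a (X \<omega>) \<partial>P) \<le> 0"
proof -
  interpret prob_space P by fact
  interpret finite_measure_subalgebra P G by standard fact
  have X: "integrable P X" and Xa: "AE \<omega> in P. real_cond_exp P G (\<lambda>\<omega>. truncated a (X \<omega>)) \<omega> \<le> 0"
    using assms by (auto simp: cond_heavy_on_left_def)
  note [measurable] = borel_measurable_integrable[OF X]
  have YP [measurable]: "Y \<in> borel_measurable P"
    by (rule measurable_from_subalg[OF assms(2,4)])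
  have int: "integrable P (\<lambda>\<omega>. Y \<omega> * truncated a (X \<omega>))"
  proof (rule Bochner_Integration.integrable_bound)
    show "integrable P (\<lambda>\<omega>. C * X \<omega>)" using X by simp
    show "AE \<omega> in P. norm (Y \<omega> * truncated a (X \<omega>)) \<le> norm (C * X \<omega>)"
    proof (rule AE_I2)
      fix \<omega>
      have "0 \<le> C" using Y order_trans by blast
      then show "norm (Y \<omega> * truncated a (X \<omega>)) \<le> norm (C * X \<omega>)"
        using Y[of \<omega>] abs_truncated_le[OF \<open>0 < a\<close>, of "X \<omega>"]
        by (simp add: abs_mult mult_mono)
    qed
  qed measurable
  have "(\<integral>\<omega>. Y \<omega> * truncated a (X \<omega>) \<partial>P)
      = (\<integral>\<omega>. Y \<omega> * real_cond_exp P G (\<lambda>\<omega>. truncated a (X \<omega>)) \<omega> \<partial>P)"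
    using real_cond_exp_intg(2)[OF int] by simp
  also have "\<dots> \<le> (\<integral>\<omega>. 0 \<partial>P)"
    using real_cond_exp_intg(1)[OF int] Xa
    by (intro integral_mono_AE) (auto intro: mult_nonneg_nonpos Y elim: eventually_mono)
  finally show ?thesis by simp
qed

text \<open>
  Fubini exchanges the mixture with the expectation, and each truncation contributes at most 0. The
  integrand is dominated by \<open>C * \<bar>X\<bar>\<close> times the density of the truncation level, which is integrable.
\<close>
lemma integral_weighted_odd_majorant_nonpos:
  assumes "prob_space P" "subalgebra P G" "cond_heavy_on_left P G X"
    and [measurable]: "Y \<in> borel_measurable G" and Y: "\<And>\<omega>. 0 \<le> Y \<omega>" "\<And>\<omega>. Y \<omega> \<le> C"
  shows "(\<integral>\<omega>. Y \<omega> * odd_majorant (X \<omega>) \<partial>P) \<le> 0"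
proof -
  interpret prob_space P by fact
  interpret finite_measure_subalgebra P G by standard fact
  interpret pair_sigma_finite P "lborel :: real measure" ..
  have X: "integrable P X" using assms by (auto simp: cond_heavy_on_left_def)
  note [measurable] = borel_measurable_integrable[OF X]
  have YP [measurable]: "Y \<in> borel_measurable P"
    by (rule measurable_from_subalg[OF assms(2,4)])
  have C: "0 \<le> C" using Y order_trans by blast
  let ?f = "\<lambda>\<omega> s. Y \<omega> * (mixing_density s * truncated s (X \<omega>))"
  have f_meas [measurable]: "case_prod ?f \<in> borel_measurable (P \<Otimes>\<^sub>M lborel)"
    unfolding truncated_def by measurable
  have int_h: "integrable lborel mixing_density" and h1: "integral\<^sup>L lborel mixing_density = 1"
    using mixing_density_integral by (auto simp: has_bochner_integral_iff)
  have int_s: "integrable lborel (?f \<omega>)" for \<omega>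
    using odd_majorant_mixture_of_truncations[of "X \<omega>"] by (simp add: has_bochner_integral_iff)
  have bound: "norm (?f \<omega> s) \<le> C * \<bar>X \<omega>\<bar> * mixing_density s" for \<omega> s
  proof (cases "0 < s")
    case True
    then have "Y \<omega> * (mixing_density s * \<bar>truncated s (X \<omega>)\<bar>) \<le> C * (mixing_density s * \<bar>X \<omega>\<bar>)"
      using Y[of \<omega>] C abs_truncated_le[OF True, of "X \<omega>"] mixing_density_nonneg[of s]
      by (intro mult_mono mult_left_mono) auto
    then show ?thesis using Y[of \<omega>] mixing_density_nonneg[of s] by (simp add: abs_mult mult_ac)
  qed (auto simp: mixing_density_def indicator_def)
  have "integrable (P \<Otimes>\<^sub>M lborel) (case_prod ?f)"
  proof (rule Fubini_integrable)
    show "integrable P (\<lambda>\<omega>. \<integral>s. norm (case_prod ?f (\<omega>, s)) \<partial>lborel)"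
    proof (rule Bochner_Integration.integrable_bound)
      show "integrable P (\<lambda>\<omega>. C * \<bar>X \<omega>\<bar>)" using X by simp
      show "AE \<omega> in P. norm (\<integral>s. norm (case_prod ?f (\<omega>, s)) \<partial>lborel) \<le> norm (C * \<bar>X \<omega>\<bar>)"
      proof (rule AE_I2)
        fix \<omega>
        have "(\<integral>s. norm (?f \<omega> s) \<partial>lborel) \<le> (\<integral>s. C * \<bar>X \<omega>\<bar> * mixing_density s \<partial>lborel)"
          using int_s[of \<omega>] int_h bound by (intro integral_mono integrable_norm) auto
        also have "\<dots> = C * \<bar>X \<omega>\<bar>" by (simp add: h1)
        finally show "norm (\<integral>s. norm (case_prod ?f (\<omega>, s)) \<partial>lborel) \<le> norm (C * \<bar>X \<omega>\<bar>)"
          using C by simp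
      qed
    qed measurable
  qed (use int_s in auto)
  note Fubini = Fubini_integral[OF this]
  have "(\<integral>\<omega>. Y \<omega> * odd_majorant (X \<omega>) \<partial>P) = (\<integral>\<omega>. (\<integral>s. ?f \<omega> s \<partial>lborel) \<partial>P)"
    by (simp add: has_bochner_integral_integral_eq[OF odd_majorant_mixture_of_truncations])
  also have "\<dots> = (\<integral>s. (\<integral>\<omega>. ?f \<omega> s \<partial>P) \<partial>lborel)" by (rule Fubini[symmetric])
  also have "\<dots> = (\<integral>s. mixing_density s * (\<integral>\<omega>. Y \<omega> * truncated s (X \<omega>) \<partial>P) \<partial>lborel)"
    by (subst integral_mult_right_zero[symmetric]) (simp add: mult_ac)
  also have "\<dots> \<le> 0"
  proof -
    have "mixing_density s * (\<integral>\<omega>. Y \<omega> * truncated s (X \<omega>) \<partial>P) \<le> 0" for s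
    proof (cases "0 < s")
      case True
      then show ?thesis
        using integral_weighted_truncated_nonpos[OF assms(1-4) Y True] mixing_density_nonneg[of s]
        by (intro mult_nonneg_nonpos) auto
    qed (auto simp: mixing_density_def indicator_def)
    then have "0 \<le> (\<integral>s. - (mixing_density s * (\<integral>\<omega>. Y \<omega> * truncated s (X \<omega>) \<partial>P)) \<partial>lborel)"
      by (intro Bochner_Integration.integral_nonneg) simp
    then show ?thesis by simp
  qed
  finally show ?thesis .
qed

text \<open>
  This says that the conditional mean of \<open>exp (X - X\<^sup>2 / 2)\<close> is at most 1, in the form in which it
  is used: the weight \<open>Y\<close> will be the product over the earlier increments.
\<close>
lemma integral_weighted_exp_le:
  assumes "prob_space P" "subalgebra P G" "cond_heavy_on_left P G X"
    and [measurable]: "Y \<in> borel_measurable G" and Y: "\<And>\<omega>. 0 \<le> Y \<omega>" "\<And>\<omega>. Y \<omega> \<le> C"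
  shows "(\<integral>\<omega>. Y \<omega> * exp (X \<omega> - (X \<omega>)\<^sup>2 / 2) \<partial>P) \<le> (\<integral>\<omega>. Y \<omega> \<partial>P)"
proof -
  interpret prob_space P by fact
  have X: "integrable P X" using assms by (auto simp: cond_heavy_on_left_def)
  note [measurable] = borel_measurable_integrable[OF X]
  have YP [measurable]: "Y \<in> borel_measurable P"
    by (rule measurable_from_subalg[OF assms(2,4)])
  have C: "0 \<le> C" using Y order_trans by blast
  have int_Y: "integrable P Y" by (rule integrable_const_bound[where B = C]) (use Y in auto)
  have int_odd: "integrable P (\<lambda>\<omega>. Y \<omega> * odd_majorant (X \<omega>))"
  proof (rule integrable_const_bound[where B = C])
    show "AE \<omega> in P. norm (Y \<omega> * odd_majorant (X \<omega>)) \<le> C"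
      using Y C abs_odd_majorant_le_1 mult_mono[of "Y _" C "\<bar>odd_majorant _\<bar>" 1]
      by (auto simp: abs_mult)
  qed measurable
  have "(\<integral>\<omega>. Y \<omega> * exp (X \<omega> - (X \<omega>)\<^sup>2 / 2) \<partial>P) \<le> (\<integral>\<omega>. Y \<omega> + Y \<omega> * odd_majorant (X \<omega>) \<partial>P)"
  proof (rule integral_mono')
    show "integrable P (\<lambda>\<omega>. Y \<omega> + Y \<omega> * odd_majorant (X \<omega>))" using int_Y int_odd by simp
    fix \<omega>
    have "Y \<omega> * exp (X \<omega> - (X \<omega>)\<^sup>2 / 2) \<le> Y \<omega> * (1 + odd_majorant (X \<omega>))"
      by (intro mult_left_mono exp_minus_half_square_le_odd_majorant Y)
    then show "Y \<omega> * exp (X \<omega> - (X \<omega>)\<^sup>2 / 2) \<le> Y \<omega> + Y \<omega> * odd_majorant (X \<omega>)"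
      by (simp add: algebra_simps)
    moreover have "0 \<le> Y \<omega> * exp (X \<omega> - (X \<omega>)\<^sup>2 / 2)" using Y by simp
    ultimately show "0 \<le> Y \<omega> + Y \<omega> * odd_majorant (X \<omega>)" by linarith
  qed
  also have "\<dots> \<le> (\<integral>\<omega>. Y \<omega> \<partial>P)"
    using int_Y int_odd integral_weighted_odd_majorant_nonpos[OF assms(1-4) Y] by simp
  finally show ?thesis .
qed

section \<open>The exponential supermartingale and its tail bounds\<close>

text \<open>It makes the exponential products bounded, so that integrability is automatic.\<close>
lemma half_square_completion_le: "y - y\<^sup>2 / 2 \<le> (1 / 2 :: real)"
  using zero_le_power2[of "y - 1"] by (simp add: power2_eq_square algebra_simps)

text \<open>
  By induction on \<open>k\<close>: removing the last factor does not decrease the mean, since the other factors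
  are measurable in the past of that increment.
\<close>
lemma exponential_supermartingale:
  assumes "prob_space P" and mds: "sq_int_martingale_differences P n F \<xi>"
    and heavy: "\<And>i. i \<in> {1..n} \<Longrightarrow> cond_heavy_on_left P (F (i - 1)) (\<xi> i)"
    and "0 < t" "k \<le> n"
  shows "(\<integral>\<omega>. exp (\<Sum>i=1..k. t * \<xi> i \<omega> - (t * \<xi> i \<omega>)\<^sup>2 / 2) \<partial>P) \<le> 1"
  using \<open>k \<le> n\<close>
proof (induction k)
  case 0
  interpret prob_space P by fact
  show ?case by (simp add: prob_space)
next
  case (Suc k)
  let ?Y = "\<lambda>\<omega>. exp (\<Sum>i=1..k. t * \<xi> i \<omega> - (t * \<xi> i \<omega>)\<^sup>2 / 2)"
  have sub: "subalgebra P (F k)"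
    using mds Suc.prems by (simp add: sq_int_martingale_differences_def)
  have "cond_heavy_on_left P (F k) (\<lambda>\<omega>. t * \<xi> (Suc k) \<omega>)"
    using heavy[of "Suc k"] Suc.prems
    by (intro cond_heavy_on_left_mult[OF \<open>prob_space P\<close> sub _ \<open>0 < t\<close>]) auto
  moreover have "?Y \<in> borel_measurable (F k)"
  proof -
    have [measurable]: "\<xi> i \<in> borel_measurable (F k)" if "i \<in> {1..k}" for i
    proof -
      have "subalgebra (F k) (F i)"
        using that Suc.prems mds unfolding sq_int_martingale_differences_def
        by (auto simp: subalgebra_def)
      moreover have "\<xi> i \<in> borel_measurable (F i)"
        using that Suc.prems mds by (auto simp: sq_int_martingale_differences_def)
      ultimately show ?thesis by (rule measurable_from_subalg)
    qed
    show ?thesis by measurable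
  qed
  moreover have "?Y \<omega> \<le> exp (\<Sum>i=1..k. 1 / 2)" for \<omega>
    unfolding exp_le_cancel_iff by (intro sum_mono half_square_completion_le)
  ultimately have "(\<integral>\<omega>. ?Y \<omega> * exp (t * \<xi> (Suc k) \<omega> - (t * \<xi> (Suc k) \<omega>)\<^sup>2 / 2) \<partial>P)
      \<le> (\<integral>\<omega>. ?Y \<omega> \<partial>P)"
    by (intro integral_weighted_exp_le[OF \<open>prob_space P\<close> sub,
          where C = "exp (\<Sum>i=1..k. 1 / 2)"]) auto
  also have "\<dots> \<le> 1" using Suc by simp
  finally show ?case by (simp add: exp_add)
qed

text \<open>
  A single exponent \<open>t\<close> serves the whole slice: on it \<open>t V\<close> stays within distance 1 of the optimal
  value \<open>x\<close>, and this loses only the factor \<open>sqrt e\<close> in the Gaussian bound.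
\<close>
lemma self_normalized_slice:
  assumes "prob_space P" and mds: "sq_int_martingale_differences P n F \<xi>"
    and heavy: "\<And>i. i \<in> {1..n} \<Longrightarrow> cond_heavy_on_left P (F (i - 1)) (\<xi> i)"
    and "0 < c" "0 < x"
  defines "S \<equiv> \<lambda>\<omega>. \<Sum>i=1..n. \<xi> i \<omega>" and "V \<equiv> \<lambda>\<omega>. sqrt (\<Sum>i=1..n. (\<xi> i \<omega>)\<^sup>2)"
  shows "measure P {\<omega> \<in> space P. x \<le> S \<omega> / V \<omega> \<and> c \<le> V \<omega> \<and> V \<omega> \<le> c * (1 + 1 / x)}
         \<le> sqrt (exp 1) * exp (- (1 / 2) * x\<^sup>2)"
proof -
  interpret prob_space P by fact
  \<comment> \<open>The exponent that is optimal at the left end \<open>V = c\<close> of the slice.\<close>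
  define t where "t = x / c"
  have t: "0 < t" using assms by (simp add: t_def)
  let ?U = "\<lambda>\<omega>. exp (\<Sum>i=1..n. t * \<xi> i \<omega> - (t * \<xi> i \<omega>)\<^sup>2 / 2)"
  have [measurable]: "\<xi> i \<in> borel_measurable P" if "i \<in> {1..n}" for i
    using that mds measurable_from_subalg[of P "F i" "\<xi> i" borel]
    by (auto simp: sq_int_martingale_differences_def)
  have int_U: "integrable P ?U"
  proof (rule integrable_const_bound[where B = "exp (\<Sum>i=1..n. 1 / 2)"])
    show "AE \<omega> in P. norm (?U \<omega>) \<le> exp (\<Sum>i=1..n. 1 / 2)"
      unfolding real_norm_def abs_exp_cancel exp_le_cancel_iff
      by (intro AE_I2 sum_mono half_square_completion_le)
  qed measurable
  have U_ge: "exp (x\<^sup>2 / 2 - 1 / 2) \<le> ?U \<omega>"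
    if "x \<le> S \<omega> / V \<omega>" "c \<le> V \<omega>" "V \<omega> \<le> c * (1 + 1 / x)" for \<omega>
  proof -
    have "0 < V \<omega>" using that \<open>0 < c\<close> by linarith
    then have S: "x * V \<omega> \<le> S \<omega>" using that by (simp add: field_simps)
    define u where "u = t * V \<omega>"
    have "x \<le> u" using that \<open>0 < c\<close> \<open>0 < x\<close> by (simp add: u_def t_def field_simps)
    moreover have "u \<le> x + 1"
    proof -
      have "u \<le> t * (c * (1 + 1 / x))" unfolding u_def using t that by (intro mult_left_mono) auto
      also have "\<dots> = x + 1" using \<open>0 < c\<close> \<open>0 < x\<close> by (simp add: t_def field_simps)
      finally show ?thesis .
    qed
    ultimately have "(u - x)\<^sup>2 \<le> 1\<^sup>2" by (intro power_mono) auto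
    then have "x\<^sup>2 / 2 - 1 / 2 \<le> x * u - u\<^sup>2 / 2" by (simp add: power2_eq_square algebra_simps)
    also have "\<dots> \<le> t * S \<omega> - u\<^sup>2 / 2"
      using mult_left_mono[OF S, of t] t by (simp add: u_def mult_ac)
    also have "u\<^sup>2 = t\<^sup>2 * (\<Sum>i=1..n. (\<xi> i \<omega>)\<^sup>2)"
      by (simp add: u_def V_def power_mult_distrib sum_nonneg)
    also have "t * S \<omega> - t\<^sup>2 * (\<Sum>i=1..n. (\<xi> i \<omega>)\<^sup>2) / 2
        = (\<Sum>i=1..n. t * \<xi> i \<omega> - (t * \<xi> i \<omega>)\<^sup>2 / 2)"
      by (simp add: S_def sum_subtractf sum_distrib_left sum_divide_distrib power_mult_distrib)
    finally show ?thesis by simp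
  qed
  have "measure P {\<omega> \<in> space P. x \<le> S \<omega> / V \<omega> \<and> c \<le> V \<omega> \<and> V \<omega> \<le> c * (1 + 1 / x)}
      \<le> measure P {\<omega> \<in> space P. exp (x\<^sup>2 / 2 - 1 / 2) \<le> ?U \<omega>}"
    using U_ge by (intro finite_measure_mono) auto
  also have "\<dots> \<le> (\<integral>\<omega>. ?U \<omega> \<partial>P) / exp (x\<^sup>2 / 2 - 1 / 2)"
    using int_U by (intro integral_Markov_inequality_measure[where A = "{}"]) auto
  also have "\<dots> \<le> 1 / exp (x\<^sup>2 / 2 - 1 / 2)"
    using exponential_supermartingale[OF assms(1) mds heavy t order_refl]
    by (intro divide_right_mono) auto
  also have "\<dots> = exp (1 / 2 + - (1 / 2) * x\<^sup>2)"
  proof -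
    have "1 / exp z = exp (- z)" for z :: real by (simp add: exp_minus divide_inverse)
    moreover have "- (x\<^sup>2 / 2 - 1 / 2) = 1 / 2 + - (1 / 2) * x\<^sup>2" by simp
    ultimately show ?thesis by metis
  qed
  also have "\<dots> = sqrt (exp 1) * exp (- (1 / 2) * x\<^sup>2)"
  proof -
    have "sqrt (exp 1) = exp (1 / 2 :: real)"
      by (rule real_sqrt_unique) (simp_all add: power2_eq_square flip: exp_add)
    then show ?thesis by (simp only: exp_add)
  qed
  finally show ?thesis .
qed

lemma geometric_cover:
  fixes d M v :: real
  assumes "1 < d" "1 \<le> v" "v \<le> M"
  obtains k where "k < Suc (nat \<lfloor>ln M / ln d\<rfloor>)" "d ^ k \<le> v" "v \<le> d ^ k * d"
proof
  define k where "k = nat \<lfloor>ln v / ln d\<rfloor>"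
  have d: "0 < ln d" using assms by simp
  have v: "0 \<le> ln v / ln d" using assms by simp
  have k: "real k \<le> ln v / ln d" "ln v / ln d < real k + 1"
    unfolding k_def using v by linarith+
  have "ln v / ln d \<le> ln M / ln d" using assms d by (intro divide_right_mono) auto
  then show "k < Suc (nat \<lfloor>ln M / ln d\<rfloor>)"
    unfolding k_def by (simp add: floor_mono less_Suc_eq_le nat_mono)
  have pow: "d ^ j = exp (real j * ln d)" for j
    using assms by (simp add: exp_of_nat_mult)
  have v_exp: "v = exp (ln v)" using assms by simp
  have "real k * ln d \<le> ln v" using k(1) d by (simp add: field_simps)
  then show "d ^ k \<le> v" unfolding pow by (subst v_exp) simp
  have "ln v \<le> real (Suc k) * ln d" using k(2) d by (simp add: field_simps)
  then have "v \<le> d ^ Suc k" unfolding pow by (subst v_exp) simp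
  then show "v \<le> d ^ k * d" by (simp add: mult.commute)
qed

lemma ln_one_plus_inverse_ge:
  fixes x :: real
  assumes "0 < x"
  shows "1 / (1 + x) \<le> ln (1 + 1 / x)"
proof -
  have "ln (x / (1 + x)) \<le> x / (1 + x) - 1" using assms by (intro ln_le_minus_one) simp
  moreover have "x / (1 + x) - 1 = - (1 / (1 + x))" using assms by (simp add: field_simps)
  moreover have "ln (1 + 1 / x) = - ln (x / (1 + x))"
    using assms by (subst ln_inverse[symmetric]) (simp_all add: field_simps)
  ultimately show ?thesis by simp
qed

theorem theorem2p3:
  fixes P :: "'a measure" and n :: nat
    and F :: "nat \<Rightarrow> 'a measure" and \<xi> :: "nat \<Rightarrow> 'a \<Rightarrow> real"
    and b M x :: real
  assumes "prob_space P"
    and "1 \<le> n"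
    and "sq_int_martingale_differences P n F \<xi>"
    and "\<And>i. i \<in> {1..n} \<Longrightarrow> cond_heavy_on_left P (F (i - 1)) (\<xi> i)"
    and "0 < b" and "1 \<le> M" and "0 < x"
  shows "measure P {\<omega> \<in> space P.
            x \<le> (\<Sum>i=1..n. \<xi> i \<omega>) / sqrt (\<Sum>i=1..n. (\<xi> i \<omega>)\<^sup>2) \<and>
            b \<le> sqrt (\<Sum>i=1..n. (\<xi> i \<omega>)\<^sup>2) \<and>
            sqrt (\<Sum>i=1..n. (\<xi> i \<omega>)\<^sup>2) \<le> b * M}
         \<le> sqrt (exp 1) * (1 + 2 * (1 + x) * ln M) * exp (- (1 / 2) * x\<^sup>2)"
proof -
  interpret prob_space P by fact
  define S where "S = (\<lambda>\<omega>. \<Sum>i=1..n. \<xi> i \<omega>)"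
  define V where "V = (\<lambda>\<omega>. sqrt (\<Sum>i=1..n. (\<xi> i \<omega>)\<^sup>2))"
  \<comment> \<open>The ratio of the endpoints of a slice.\<close>
  define d where "d = 1 + 1 / x"
  define K where "K = Suc (nat \<lfloor>ln M / ln d\<rfloor>)"
  define A where "A = (\<lambda>k. {\<omega> \<in> space P. x \<le> S \<omega> / V \<omega> \<and> b * d ^ k \<le> V \<omega> \<and> V \<omega> \<le> b * d ^ k * d})"
  have d: "1 < d" using \<open>0 < x\<close> by (simp add: d_def)
  have [measurable]: "\<xi> i \<in> borel_measurable P" if "i \<in> {1..n}" for i
    using that assms(3) measurable_from_subalg[of P "F i" "\<xi> i" borel]
    by (auto simp: sq_int_martingale_differences_def)
  have A_sets: "A k \<in> sets P" for k unfolding A_def S_def V_def by measurable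
  have "{\<omega> \<in> space P. x \<le> S \<omega> / V \<omega> \<and> b \<le> V \<omega> \<and> V \<omega> \<le> b * M} \<subseteq> (\<Union>k<K. A k)"
  proof safe
    fix \<omega> assume \<omega>: "\<omega> \<in> space P" "x \<le> S \<omega> / V \<omega>" "b \<le> V \<omega>" "V \<omega> \<le> b * M"
    have "1 \<le> V \<omega> / b" "V \<omega> / b \<le> M" using \<omega> \<open>0 < b\<close> by (auto simp: field_simps)
    then obtain k where "k < K" "d ^ k \<le> V \<omega> / b" "V \<omega> / b \<le> d ^ k * d"
      unfolding K_def by (rule geometric_cover[OF d])
    then have "k < K" "\<omega> \<in> A k" using \<omega> \<open>0 < b\<close> by (auto simp: A_def field_simps)
    then show "\<omega> \<in> (\<Union>k<K. A k)" by blast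
  qed
  then have "measure P {\<omega> \<in> space P. x \<le> S \<omega> / V \<omega> \<and> b \<le> V \<omega> \<and> V \<omega> \<le> b * M}
      \<le> measure P (\<Union>k<K. A k)"
    using A_sets by (intro finite_measure_mono) auto
  also have "\<dots> \<le> (\<Sum>k<K. measure P (A k))"
    using A_sets by (intro finite_measure_subadditive_finite) auto
  also have "\<dots> \<le> (\<Sum>k<K. sqrt (exp 1) * exp (- (1 / 2) * x\<^sup>2))"
  proof (rule sum_mono)
    fix k
    have "0 < b * d ^ k" using \<open>0 < b\<close> d by simp
    from self_normalized_slice[OF assms(1,3,4) this \<open>0 < x\<close>]
    show "measure P (A k) \<le> sqrt (exp 1) * exp (- (1 / 2) * x\<^sup>2)"
      unfolding A_def S_def V_def d_def .
  qed
  also have "\<dots> = sqrt (exp 1) * real K * exp (- (1 / 2) * x\<^sup>2)" by simp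
  also have "\<dots> \<le> sqrt (exp 1) * (1 + 2 * (1 + x) * ln M) * exp (- (1 / 2) * x\<^sup>2)"
  proof -
    have ln_M: "0 \<le> ln M" using \<open>1 \<le> M\<close> by simp
    have "0 < ln d" using d by simp
    then have "real K \<le> 1 + ln M / ln d"
      using ln_M unfolding K_def by (simp add: of_nat_nat)
    also have "ln M / ln d \<le> ln M / (1 / (1 + x))"
      using ln_one_plus_inverse_ge[OF \<open>0 < x\<close>] ln_M \<open>0 < x\<close> \<open>0 < ln d\<close>
      by (intro divide_left_mono) (auto simp: d_def)
    also have "\<dots> \<le> 2 * (1 + x) * ln M" using mult_nonneg_nonneg[OF ln_M, of "1 + x"] \<open>0 < x\<close> by (simp add: algebra_simps)
    finally show ?thesis by (intro mult_right_mono mult_left_mono) auto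
  qed
  finally show ?thesis unfolding S_def V_def .
qed

end
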